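(* Let $\Gamma$ be the context $x_1:\mathbb N,\dots,x_m:\mathbb N,X_1:\mathrm{Set}(\mathbb N),\dots,X_n:\mathrm{Set}(\mathbb N)$ and let $\phi$ be a formula of $\mathcal L$ with free variables among $x_1,\dots,x_m,X_1,\dots,X_n$. If $\mathrm{ACA}_0\vdash\phi$, then $\Gamma\vdash\ \Rightarrow\langle\phi\rangle$ is derivable in $\mathrm{T}_2$.
   Context: Second order arithmetic. The language $\mathcal L$ has number variables $x,y,z,\dots$ and set variables $X,Y,Z,\dots$; terms $t::=x\mid 0\mid \mathrm S t\mid t+t\mid t\cdot t$; formulas $\phi::=t=t\mid t\in X\mid\bot\mid\phi\supset\phi\mid\forall x\phi\mid\forall X\phi$, other connectives defined classically. A formula is arithmetic if it contains no set quantifier. $\mathrm{ACA}_0$ is the classical two-sorted theory with equality with axioms: $\mathrm Sx\neq0$; $\mathrm Sx=\mathrm Sy\supset x=y$; $x+0=x$; $x+\mathrm Sy=\mathrm S(x+y)$; $x\cdot0=0$; $x\cdot\mathrm Sy=x\cdot y+x$; $\exists X\forall x(x\in X\leftrightarrow\phi)$ for each arithmetic $\phi$ not containing $X$ free; $0\in X\supset\forall x(x\in X\supset\mathrm Sx\in X)\supset\forall x.\,x\in X$. The logic-enriched type theory $\mathrm{T}_2$. Types: $\mathbb N$ and $\mathrm{Set}(\mathbb N)$. Terms: $M::=x\mid0\mid\mathrm sM\mid\mathrm R(M,[x,y]M,M)\mid\{x:\mathbb N\mid P\}$. Small propositions: $P::=M\mathbin{\hat=}_{\mathbb N}M\mid\hat\bot\mid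 P\mathbin{\hat\supset}P\mid\hat\forall x{:}\hat{\mathbb N}.P\mid M\mathbin{\hat\in}_{\mathbb N}M$. Propositions: $\phi::=M=_{\mathbb N}M\mid\bot\mid\phi\supset\phi\mid\forall x{:}A.\phi\mid V(P)$ ($A$ a type). Abbreviations $\neg\phi:=\phi\supset\bot$, classical $\wedge,\vee,\leftrightarrow,\exists$, $M\in_{\mathbb N}N:=V(M\mathbin{\hat\in}_{\mathbb N}N)$, hatted analogues. Judgements $\Gamma\vdash\mathcal J$ for $\mathcal J$ among $\mathrm{valid}$, $A$ type, $A=B$, $M:A$, $M=N:A$, $P$ prop, $P=Q$, $\phi$ Prop, $\phi=\psi$, $\phi_1,\dots,\phi_n\Rightarrow\psi$. Rules: standard structural rules (context formation, variables, judgemental equalities are equivalences, transfer along type equality, $\Gamma\vdash\phi_1,\dots,\phi_n\Rightarrow\phi_i$, replacement of an entailed proposition by an equal one); congruence rules for all constructors; $0:\mathbb N$, $\mathrm sM:\mathbb N$; if $\Gamma\vdash L:\mathbb N$, $\Gamma,x{:}\mathbb N,y{:}\mathbb N\vdash M:\mathbb N$, $\Gamma\vdash N:\mathbb N$ then $\mathrm R(L,[x,y]M,N):\mathbb N$, with $\mathrm R(L,[x,y]M,0)=L$ and $\mathrm R(L,[x,y]M,\mathrm sN)=[N/x,\mathrm R(L,[x,y]M,N)/y]M$; $\{x:\mathbb N\mid P\}:\mathrm{Set}(\mathbb N)$ when $\Gamma,x{:}\mathbb N\vdash P$ prop; $M\mathbin{\hat\in}_{\mathbb N}N$ prop for $M:\mathbb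 N,N:\mathrm{Set}(\mathbb N)$, with $(M\mathbin{\hat\in}_{\mathbb N}\{x:\mathbb N\mid P\})=[M/x]P$; $V(P)$ Prop for $P$ prop; $V(\hat\bot)=\bot$; $V(P\mathbin{\hat\supset}Q)=V(P)\supset V(Q)$; $\hat\forall x{:}\hat{\mathbb N}.P$ prop with $V(\hat\forall x{:}\hat{\mathbb N}.P)=\forall x{:}\mathbb N.V(P)$ when $\Gamma,x{:}\mathbb N\vdash P$ prop; $M_1=_{\mathbb N}M_2$ Prop, $M_1\mathbin{\hat=}_{\mathbb N}M_2$ prop and $V(M_1\mathbin{\hat=}_{\mathbb N}M_2)=(M_1=_{\mathbb N}M_2)$ for $M_i:\mathbb N$; classical predicate logic ($\bot$-elim, $\supset$ intro/elim, double negation elimination, $\forall$ intro/elim); reflexivity $\Phi\Rightarrow M=_{\mathbb N}M$ and substitution (from $\Gamma,x{:}\mathbb N\vdash\phi$ Prop, $\Phi\Rightarrow M_1=_{\mathbb N}M_2$, $\Phi\Rightarrow[M_1/x]\phi$ infer $\Phi\Rightarrow[M_2/x]\phi$); induction only for small propositions: from $\Gamma,x{:}\mathbb N\vdash P$ prop, $\Gamma\vdash N:\mathbb N$, $\Gamma\vdash\Phi\Rightarrow V([0/x]P)$, $\Gamma,x{:}\mathbb N\vdash\Phi,V(P)\Rightarrow V([\mathrm sx/x]P)$ infer $\Gamma\vdash\Phi\Rightarrow V([N/x]P)$; and the axiom $\Gamma\vdash\phi_1,\dots,\phi_n\Rightarrow\neg(0=_{\mathbb N}\mathrm sM)$ for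 $\Gamma\vdash M:\mathbb N$. Translation: $\langle x\rangle\equiv x$, $\langle0\rangle\equiv0$, $\langle\mathrm St\rangle\equiv\mathrm s\langle t\rangle$, $\langle s+t\rangle\equiv\langle s\rangle\ \mathtt{plus}\ \langle t\rangle$, $\langle s\cdot t\rangle\equiv\langle s\rangle\ \mathtt{times}\ \langle t\rangle$ with $M\ \mathtt{plus}\ N\equiv\mathrm R(M,[x,y]\mathrm sy,N)$, $M\ \mathtt{times}\ N\equiv\mathrm R(0,[x,y]\,y\ \mathtt{plus}\ M,N)$; $\langle s=t\rangle\equiv\langle s\rangle=_{\mathbb N}\langle t\rangle$, $\langle t\in X\rangle\equiv\langle t\rangle\in_{\mathbb N}X$, $\langle\neg\phi\rangle\equiv\neg\langle\phi\rangle$, $\langle\phi\supset\psi\rangle\equiv\langle\phi\rangle\supset\langle\psi\rangle$, $\langle\forall x\phi\rangle\equiv\forall x{:}\mathbb N.\langle\phi\rangle$, $\langle\forall X\phi\rangle\equiv\forall X{:}\mathrm{Set}(\mathbb N).\langle\phi\rangle$. *)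

theory Defs
  imports Main
begin

section \<open>Second order arithmetic\<close>

text \<open>
  Variables of both calculi are de Bruijn indices. In the language of second order arithmetic,
  number variables and set variables have separate index spaces; an index that exceeds the number
  of enclosing quantifiers of its sort denotes a free variable.
\<close>

datatype ltm =
    LVar nat
  | LZero
  | LSuc ltm
  | LPlus ltm ltm
  | LTimes ltm ltm

datatype lfm =
    LEq ltm ltm
  | LMem ltm nat
  | LBot
  | LImp lfm lfm
  | LAllN lfm
  | LAllS lfm

abbreviation LNeg :: "lfm \<Rightarrow> lfm" where
  "LNeg \<phi> \<equiv> LImp \<phi> LBot"

abbreviation LConj :: "lfm \<Rightarrow> lfm \<Rightarrow> lfm" where
  "LConj \<phi> \<psi> \<equiv> LNeg (LImp \<phi> (LNeg \<psi>))"

abbreviation LIff :: "lfm \<Rightarrow> lfm \<Rightarrow> lfm" where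
  "LIff \<phi> \<psi> \<equiv> LConj (LImp \<phi> \<psi>) (LImp \<psi> \<phi>)"

abbreviation LExS :: "lfm \<Rightarrow> lfm" where
  "LExS \<phi> \<equiv> LNeg (LAllS (LNeg \<phi>))"

primrec arithmetic :: "lfm \<Rightarrow> bool" where
  "arithmetic (LEq s t) = True"
| "arithmetic (LMem t X) = True"
| "arithmetic LBot = True"
| "arithmetic (LImp \<phi> \<psi>) = (arithmetic \<phi> \<and> arithmetic \<psi>)"
| "arithmetic (LAllN \<phi>) = arithmetic \<phi>"
| "arithmetic (LAllS \<phi>) = False"

primrec ltm_fv :: "ltm \<Rightarrow> nat set" where
  "ltm_fv (LVar x) = {x}"
| "ltm_fv LZero = {}"
| "ltm_fv (LSuc t) = ltm_fv t"
| "ltm_fv (LPlus s t) = ltm_fv s \<union> ltm_fv t"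
| "ltm_fv (LTimes s t) = ltm_fv s \<union> ltm_fv t"

primrec num_fv :: "lfm \<Rightarrow> nat set" where
  "num_fv (LEq s t) = ltm_fv s \<union> ltm_fv t"
| "num_fv (LMem t X) = ltm_fv t"
| "num_fv LBot = {}"
| "num_fv (LImp \<phi> \<psi>) = num_fv \<phi> \<union> num_fv \<psi>"
| "num_fv (LAllN \<phi>) = {x. Suc x \<in> num_fv \<phi>}"
| "num_fv (LAllS \<phi>) = num_fv \<phi>"

primrec set_fv :: "lfm \<Rightarrow> nat set" where
  "set_fv (LEq s t) = {}"
| "set_fv (LMem t X) = {X}"
| "set_fv LBot = {}"
| "set_fv (LImp \<phi> \<psi>) = set_fv \<phi> \<union> set_fv \<psi>"
| "set_fv (LAllN \<phi>) = set_fv \<phi>"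
| "set_fv (LAllS \<phi>) = {X. Suc X \<in> set_fv \<phi>}"

primrec ltm_subst :: "(nat \<Rightarrow> ltm) \<Rightarrow> ltm \<Rightarrow> ltm" where
  "ltm_subst f (LVar x) = f x"
| "ltm_subst f LZero = LZero"
| "ltm_subst f (LSuc t) = LSuc (ltm_subst f t)"
| "ltm_subst f (LPlus s t) = LPlus (ltm_subst f s) (ltm_subst f t)"
| "ltm_subst f (LTimes s t) = LTimes (ltm_subst f s) (ltm_subst f t)"

definition ltm_up :: "(nat \<Rightarrow> ltm) \<Rightarrow> nat \<Rightarrow> ltm" where
  "ltm_up f = case_nat (LVar 0) (\<lambda>x. ltm_subst (\<lambda>y. LVar (Suc y)) (f x))"

primrec num_subst :: "(nat \<Rightarrow> ltm) \<Rightarrow> lfm \<Rightarrow> lfm" where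
  "num_subst f (LEq s t) = LEq (ltm_subst f s) (ltm_subst f t)"
| "num_subst f (LMem t X) = LMem (ltm_subst f t) X"
| "num_subst f LBot = LBot"
| "num_subst f (LImp \<phi> \<psi>) = LImp (num_subst f \<phi>) (num_subst f \<psi>)"
| "num_subst f (LAllN \<phi>) = LAllN (num_subst (ltm_up f) \<phi>)"
| "num_subst f (LAllS \<phi>) = LAllS (num_subst f \<phi>)"

definition ren_up :: "(nat \<Rightarrow> nat) \<Rightarrow> nat \<Rightarrow> nat" where
  "ren_up r = case_nat 0 (\<lambda>x. Suc (r x))"

text \<open>Set variables are the only set terms, so substitution for them is renaming.\<close>

primrec set_subst :: "(nat \<Rightarrow> nat) \<Rightarrow> lfm \<Rightarrow> lfm" where
  "set_subst r (LEq s t) = LEq s t"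
| "set_subst r (LMem t X) = LMem t (r X)"
| "set_subst r LBot = LBot"
| "set_subst r (LImp \<phi> \<psi>) = LImp (set_subst r \<phi>) (set_subst r \<psi>)"
| "set_subst r (LAllN \<phi>) = LAllN (set_subst r \<phi>)"
| "set_subst r (LAllS \<phi>) = LAllS (set_subst (ren_up r) \<phi>)"

abbreviation num_inst :: "ltm \<Rightarrow> lfm \<Rightarrow> lfm" where
  "num_inst t \<equiv> num_subst (case_nat t LVar)"

abbreviation num_lift :: "lfm \<Rightarrow> lfm" where
  "num_lift \<equiv> num_subst (\<lambda>x. LVar (Suc x))"

abbreviation set_inst :: "nat \<Rightarrow> lfm \<Rightarrow> lfm" where
  "set_inst Y \<equiv> set_subst (case_nat Y (\<lambda>X. X))"

abbreviation set_lift :: "lfm \<Rightarrow> lfm" where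
  "set_lift \<equiv> set_subst Suc"

text \<open>
  In the comprehension axiom, number index 0 in \<open>\<phi>\<close> is the variable $x$ and set index 0 is $X$.
\<close>

inductive ACA0_axiom :: "lfm \<Rightarrow> bool" where
  Suc_neq_0: "ACA0_axiom (LNeg (LEq (LSuc (LVar x)) LZero))"
| Suc_inject: "ACA0_axiom (LImp (LEq (LSuc (LVar x)) (LSuc (LVar y))) (LEq (LVar x) (LVar y)))"
| plus_0: "ACA0_axiom (LEq (LPlus (LVar x) LZero) (LVar x))"
| plus_Suc: "ACA0_axiom (LEq (LPlus (LVar x) (LSuc (LVar y))) (LSuc (LPlus (LVar x) (LVar y))))"
| times_0: "ACA0_axiom (LEq (LTimes (LVar x) LZero) LZero)"
| times_Suc: "ACA0_axiom
    (LEq (LTimes (LVar x) (LSuc (LVar y))) (LPlus (LTimes (LVar x) (LVar y)) (LVar x)))"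
| comprehension: "arithmetic \<phi> \<Longrightarrow> 0 \<notin> set_fv \<phi> \<Longrightarrow>
    ACA0_axiom (LExS (LAllN (LIff (LMem (LVar 0) 0) \<phi>)))"
| induction: "ACA0_axiom
    (LImp (LMem LZero X)
      (LImp (LAllN (LImp (LMem (LVar 0) X) (LMem (LSuc (LVar 0)) X)))
        (LAllN (LMem (LVar 0) X))))"

text \<open>Classical two-sorted natural deduction with equality, over the axioms above.\<close>

inductive ACA0_entails :: "lfm list \<Rightarrow> lfm \<Rightarrow> bool" where
  axiom: "ACA0_axiom \<phi> \<Longrightarrow> ACA0_entails \<Phi> \<phi>"
| hyp: "\<phi> \<in> set \<Phi> \<Longrightarrow> ACA0_entails \<Phi> \<phi>"
| botE: "ACA0_entails \<Phi> LBot \<Longrightarrow> ACA0_entails \<Phi> \<phi>"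
| impI: "ACA0_entails (\<phi> # \<Phi>) \<psi> \<Longrightarrow> ACA0_entails \<Phi> (LImp \<phi> \<psi>)"
| impE: "ACA0_entails \<Phi> (LImp \<phi> \<psi>) \<Longrightarrow> ACA0_entails \<Phi> \<phi> \<Longrightarrow> ACA0_entails \<Phi> \<psi>"
| dne: "ACA0_entails \<Phi> (LNeg (LNeg \<phi>)) \<Longrightarrow> ACA0_entails \<Phi> \<phi>"
| allNI: "ACA0_entails (map num_lift \<Phi>) \<phi> \<Longrightarrow> ACA0_entails \<Phi> (LAllN \<phi>)"
| allNE: "ACA0_entails \<Phi> (LAllN \<phi>) \<Longrightarrow> ACA0_entails \<Phi> (num_inst t \<phi>)"
| allSI: "ACA0_entails (map set_lift \<Phi>) \<phi> \<Longrightarrow> ACA0_entails \<Phi> (LAllS \<phi>)"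
| allSE: "ACA0_entails \<Phi> (LAllS \<phi>) \<Longrightarrow> ACA0_entails \<Phi> (set_inst Y \<phi>)"
| eq_refl: "ACA0_entails \<Phi> (LEq t t)"
| eq_subst: "ACA0_entails \<Phi> (LEq s t) \<Longrightarrow> ACA0_entails \<Phi> (num_inst s \<phi>) \<Longrightarrow>
    ACA0_entails \<Phi> (num_inst t \<phi>)"

definition ACA0_provable :: "lfm \<Rightarrow> bool" where
  "ACA0_provable \<phi> \<longleftrightarrow> ACA0_entails [] \<phi>"

section \<open>The logic-enriched type theory\<close>

datatype ty = TyN | TySetN

text \<open>
  Here all variables share one index space. In \<open>Rec L M N\<close>, for $R(L,[x,y]M,N)$, the term \<open>M\<close>
  binds two variables: index 0 is $y$ (the recursive value) and index 1 is $x$ (the predecessor).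
\<close>

datatype tm =
    Var nat
  | Zero
  | Succ tm
  | Rec tm tm tm
  | Compr sprop
and sprop =
    SEq tm tm
  | SBot
  | SImp sprop sprop
  | SAll sprop
  | SMem tm tm

datatype lprop =
    Eq tm tm
  | Bot
  | Imp lprop lprop
  | All ty lprop
  | V sprop

abbreviation Neg :: "lprop \<Rightarrow> lprop" where
  "Neg \<phi> \<equiv> Imp \<phi> Bot"

abbreviation Mem :: "tm \<Rightarrow> tm \<Rightarrow> lprop" where
  "Mem M N \<equiv> V (SMem M N)"

primrec tm_ren :: "(nat \<Rightarrow> nat) \<Rightarrow> tm \<Rightarrow> tm"
  and sprop_ren :: "(nat \<Rightarrow> nat) \<Rightarrow> sprop \<Rightarrow> sprop" where
  "tm_ren r (Var x) = Var (r x)"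
| "tm_ren r Zero = Zero"
| "tm_ren r (Succ M) = Succ (tm_ren r M)"
| "tm_ren r (Rec L M N) = Rec (tm_ren r L) (tm_ren (ren_up (ren_up r)) M) (tm_ren r N)"
| "tm_ren r (Compr P) = Compr (sprop_ren (ren_up r) P)"
| "sprop_ren r (SEq M N) = SEq (tm_ren r M) (tm_ren r N)"
| "sprop_ren r SBot = SBot"
| "sprop_ren r (SImp P Q) = SImp (sprop_ren r P) (sprop_ren r Q)"
| "sprop_ren r (SAll P) = SAll (sprop_ren (ren_up r) P)"
| "sprop_ren r (SMem M N) = SMem (tm_ren r M) (tm_ren r N)"

definition tm_up :: "(nat \<Rightarrow> tm) \<Rightarrow> nat \<Rightarrow> tm" where
  "tm_up f = case_nat (Var 0) (\<lambda>x. tm_ren Suc (f x))"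

primrec tm_subst :: "(nat \<Rightarrow> tm) \<Rightarrow> tm \<Rightarrow> tm"
  and sprop_subst :: "(nat \<Rightarrow> tm) \<Rightarrow> sprop \<Rightarrow> sprop" where
  "tm_subst f (Var x) = f x"
| "tm_subst f Zero = Zero"
| "tm_subst f (Succ M) = Succ (tm_subst f M)"
| "tm_subst f (Rec L M N) = Rec (tm_subst f L) (tm_subst (tm_up (tm_up f)) M) (tm_subst f N)"
| "tm_subst f (Compr P) = Compr (sprop_subst (tm_up f) P)"
| "sprop_subst f (SEq M N) = SEq (tm_subst f M) (tm_subst f N)"
| "sprop_subst f SBot = SBot"
| "sprop_subst f (SImp P Q) = SImp (sprop_subst f P) (sprop_subst f Q)"
| "sprop_subst f (SAll P) = SAll (sprop_subst (tm_up f) P)"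
| "sprop_subst f (SMem M N) = SMem (tm_subst f M) (tm_subst f N)"

primrec lprop_subst :: "(nat \<Rightarrow> tm) \<Rightarrow> lprop \<Rightarrow> lprop" where
  "lprop_subst f (Eq M N) = Eq (tm_subst f M) (tm_subst f N)"
| "lprop_subst f Bot = Bot"
| "lprop_subst f (Imp \<phi> \<psi>) = Imp (lprop_subst f \<phi>) (lprop_subst f \<psi>)"
| "lprop_subst f (All A \<phi>) = All A (lprop_subst (tm_up f) \<phi>)"
| "lprop_subst f (V P) = V (sprop_subst f P)"

abbreviation tm_inst2 :: "tm \<Rightarrow> tm \<Rightarrow> tm \<Rightarrow> tm" where
  "tm_inst2 K L \<equiv> tm_subst (case_nat L (case_nat K Var))"

abbreviation sprop_inst :: "tm \<Rightarrow> sprop \<Rightarrow> sprop" where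
  "sprop_inst M \<equiv> sprop_subst (case_nat M Var)"

abbreviation lprop_inst :: "tm \<Rightarrow> lprop \<Rightarrow> lprop" where
  "lprop_inst M \<equiv> lprop_subst (case_nat M Var)"

abbreviation lprop_lift :: "lprop \<Rightarrow> lprop" where
  "lprop_lift \<equiv> lprop_subst (\<lambda>x. Var (Suc x))"

datatype judgement =
    Valid
  | IsType ty
  | EqType ty ty
  | HasType tm ty
  | EqTm tm tm ty
  | IsSProp sprop
  | EqSProp sprop sprop
  | IsProp lprop
  | EqProp lprop lprop
  | Entails "lprop list" lprop

text \<open>
  A context lists the types of its variables with the most recently declared one first, so that
  $\Gamma, x : A$ is \<open>A # \<Gamma>\<close> and the variable with index \<open>i\<close> has type \<open>\<Gamma> ! i\<close>.
\<close>

inductive T2 :: "ty list \<Rightarrow> judgement \<Rightarrow> bool" (infix "\<turnstile>" 45) where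
  ctx_empty: "[] \<turnstile> Valid"
| ctx_ext: "\<Gamma> \<turnstile> IsType A \<Longrightarrow> A # \<Gamma> \<turnstile> Valid"
| var: "\<Gamma> \<turnstile> Valid \<Longrightarrow> i < length \<Gamma> \<Longrightarrow> \<Gamma> \<turnstile> HasType (Var i) (\<Gamma> ! i)"

| type_refl: "\<Gamma> \<turnstile> IsType A \<Longrightarrow> \<Gamma> \<turnstile> EqType A A"
| type_sym: "\<Gamma> \<turnstile> EqType A B \<Longrightarrow> \<Gamma> \<turnstile> EqType B A"
| type_trans: "\<Gamma> \<turnstile> EqType A B \<Longrightarrow> \<Gamma> \<turnstile> EqType B C \<Longrightarrow> \<Gamma> \<turnstile> EqType A C"
| tm_refl: "\<Gamma> \<turnstile> HasType M A \<Longrightarrow> \<Gamma> \<turnstile> EqTm M M A"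
| tm_sym: "\<Gamma> \<turnstile> EqTm M N A \<Longrightarrow> \<Gamma> \<turnstile> EqTm N M A"
| tm_trans: "\<Gamma> \<turnstile> EqTm L M A \<Longrightarrow> \<Gamma> \<turnstile> EqTm M N A \<Longrightarrow> \<Gamma> \<turnstile> EqTm L N A"
| sprop_refl: "\<Gamma> \<turnstile> IsSProp P \<Longrightarrow> \<Gamma> \<turnstile> EqSProp P P"
| sprop_sym: "\<Gamma> \<turnstile> EqSProp P Q \<Longrightarrow> \<Gamma> \<turnstile> EqSProp Q P"
| sprop_trans: "\<Gamma> \<turnstile> EqSProp P Q \<Longrightarrow> \<Gamma> \<turnstile> EqSProp Q R \<Longrightarrow> \<Gamma> \<turnstile> EqSProp P R"
| prop_refl: "\<Gamma> \<turnstile> IsProp \<phi> \<Longrightarrow> \<Gamma> \<turnstile> EqProp \<phi> \<phi>"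
| prop_sym: "\<Gamma> \<turnstile> EqProp \<phi> \<psi> \<Longrightarrow> \<Gamma> \<turnstile> EqProp \<psi> \<phi>"
| prop_trans: "\<Gamma> \<turnstile> EqProp \<phi> \<psi> \<Longrightarrow> \<Gamma> \<turnstile> EqProp \<psi> \<chi> \<Longrightarrow> \<Gamma> \<turnstile> EqProp \<phi> \<chi>"
| tm_conv: "\<Gamma> \<turnstile> HasType M A \<Longrightarrow> \<Gamma> \<turnstile> EqType A B \<Longrightarrow> \<Gamma> \<turnstile> HasType M B"
| eq_tm_conv: "\<Gamma> \<turnstile> EqTm M N A \<Longrightarrow> \<Gamma> \<turnstile> EqType A B \<Longrightarrow> \<Gamma> \<turnstile> EqTm M N B"
| hyp: "\<forall>\<phi>\<in>set \<Phi>. \<Gamma> \<turnstile> IsProp \<phi> \<Longrightarrow> \<phi> \<in> set \<Phi> \<Longrightarrow> \<Gamma> \<turnstile> Entails \<Phi> \<phi>"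
| entails_conv: "\<Gamma> \<turnstile> Entails \<Phi> \<phi> \<Longrightarrow> \<Gamma> \<turnstile> EqProp \<phi> \<psi> \<Longrightarrow> \<Gamma> \<turnstile> Entails \<Phi> \<psi>"

| N_form: "\<Gamma> \<turnstile> Valid \<Longrightarrow> \<Gamma> \<turnstile> IsType TyN"
| zero: "\<Gamma> \<turnstile> Valid \<Longrightarrow> \<Gamma> \<turnstile> HasType Zero TyN"
| succ: "\<Gamma> \<turnstile> HasType M TyN \<Longrightarrow> \<Gamma> \<turnstile> HasType (Succ M) TyN"
| succ_cong: "\<Gamma> \<turnstile> EqTm M M' TyN \<Longrightarrow> \<Gamma> \<turnstile> EqTm (Succ M) (Succ M') TyN"
| rec: "\<Gamma> \<turnstile> HasType L TyN \<Longrightarrow> TyN # TyN # \<Gamma> \<turnstile> HasType M TyN \<Longrightarrow> \<Gamma> \<turnstile> HasType N TyN \<Longrightarrow>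
    \<Gamma> \<turnstile> HasType (Rec L M N) TyN"
| rec_cong: "\<Gamma> \<turnstile> EqTm L L' TyN \<Longrightarrow> TyN # TyN # \<Gamma> \<turnstile> EqTm M M' TyN \<Longrightarrow> \<Gamma> \<turnstile> EqTm N N' TyN \<Longrightarrow>
    \<Gamma> \<turnstile> EqTm (Rec L M N) (Rec L' M' N') TyN"
| rec_zero: "\<Gamma> \<turnstile> HasType L TyN \<Longrightarrow> TyN # TyN # \<Gamma> \<turnstile> HasType M TyN \<Longrightarrow>
    \<Gamma> \<turnstile> EqTm (Rec L M Zero) L TyN"
| rec_succ: "\<Gamma> \<turnstile> HasType L TyN \<Longrightarrow> TyN # TyN # \<Gamma> \<turnstile> HasType M TyN \<Longrightarrow> \<Gamma> \<turnstile> HasType N TyN \<Longrightarrow>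
    \<Gamma> \<turnstile> EqTm (Rec L M (Succ N)) (tm_inst2 N (Rec L M N) M) TyN"

| Set_form: "\<Gamma> \<turnstile> Valid \<Longrightarrow> \<Gamma> \<turnstile> IsType TySetN"
| compr: "TyN # \<Gamma> \<turnstile> IsSProp P \<Longrightarrow> \<Gamma> \<turnstile> HasType (Compr P) TySetN"
| compr_cong: "TyN # \<Gamma> \<turnstile> EqSProp P P' \<Longrightarrow> \<Gamma> \<turnstile> EqTm (Compr P) (Compr P') TySetN"
| smem_form: "\<Gamma> \<turnstile> HasType M TyN \<Longrightarrow> \<Gamma> \<turnstile> HasType N TySetN \<Longrightarrow> \<Gamma> \<turnstile> IsSProp (SMem M N)"
| smem_cong: "\<Gamma> \<turnstile> EqTm M M' TyN \<Longrightarrow> \<Gamma> \<turnstile> EqTm N N' TySetN \<Longrightarrow>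
    \<Gamma> \<turnstile> EqSProp (SMem M N) (SMem M' N')"
| smem_compr: "\<Gamma> \<turnstile> HasType M TyN \<Longrightarrow> TyN # \<Gamma> \<turnstile> IsSProp P \<Longrightarrow>
    \<Gamma> \<turnstile> EqSProp (SMem M (Compr P)) (sprop_inst M P)"

| V_form: "\<Gamma> \<turnstile> IsSProp P \<Longrightarrow> \<Gamma> \<turnstile> IsProp (V P)"
| V_cong: "\<Gamma> \<turnstile> EqSProp P P' \<Longrightarrow> \<Gamma> \<turnstile> EqProp (V P) (V P')"

| bot_form: "\<Gamma> \<turnstile> Valid \<Longrightarrow> \<Gamma> \<turnstile> IsProp Bot"
| sbot_form: "\<Gamma> \<turnstile> Valid \<Longrightarrow> \<Gamma> \<turnstile> IsSProp SBot"
| V_bot: "\<Gamma> \<turnstile> Valid \<Longrightarrow> \<Gamma> \<turnstile> EqProp (V SBot) Bot"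
| imp_form: "\<Gamma> \<turnstile> IsProp \<phi> \<Longrightarrow> \<Gamma> \<turnstile> IsProp \<psi> \<Longrightarrow> \<Gamma> \<turnstile> IsProp (Imp \<phi> \<psi>)"
| imp_cong: "\<Gamma> \<turnstile> EqProp \<phi> \<phi>' \<Longrightarrow> \<Gamma> \<turnstile> EqProp \<psi> \<psi>' \<Longrightarrow> \<Gamma> \<turnstile> EqProp (Imp \<phi> \<psi>) (Imp \<phi>' \<psi>')"
| simp_form: "\<Gamma> \<turnstile> IsSProp P \<Longrightarrow> \<Gamma> \<turnstile> IsSProp Q \<Longrightarrow> \<Gamma> \<turnstile> IsSProp (SImp P Q)"
| simp_cong: "\<Gamma> \<turnstile> EqSProp P P' \<Longrightarrow> \<Gamma> \<turnstile> EqSProp Q Q' \<Longrightarrow> \<Gamma> \<turnstile> EqSProp (SImp P Q) (SImp P' Q')"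
| V_imp: "\<Gamma> \<turnstile> IsSProp P \<Longrightarrow> \<Gamma> \<turnstile> IsSProp Q \<Longrightarrow> \<Gamma> \<turnstile> EqProp (V (SImp P Q)) (Imp (V P) (V Q))"
| all_form: "A # \<Gamma> \<turnstile> IsProp \<phi> \<Longrightarrow> \<Gamma> \<turnstile> IsProp (All A \<phi>)"
| all_cong: "\<Gamma> \<turnstile> EqType A A' \<Longrightarrow> A # \<Gamma> \<turnstile> EqProp \<phi> \<phi>' \<Longrightarrow> \<Gamma> \<turnstile> EqProp (All A \<phi>) (All A' \<phi>')"
| sall_form: "TyN # \<Gamma> \<turnstile> IsSProp P \<Longrightarrow> \<Gamma> \<turnstile> IsSProp (SAll P)"
| sall_cong: "TyN # \<Gamma> \<turnstile> EqSProp P P' \<Longrightarrow> \<Gamma> \<turnstile> EqSProp (SAll P) (SAll P')"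
| V_all: "TyN # \<Gamma> \<turnstile> IsSProp P \<Longrightarrow> \<Gamma> \<turnstile> EqProp (V (SAll P)) (All TyN (V P))"
| eq_form: "\<Gamma> \<turnstile> HasType M TyN \<Longrightarrow> \<Gamma> \<turnstile> HasType N TyN \<Longrightarrow> \<Gamma> \<turnstile> IsProp (Eq M N)"
| eq_cong: "\<Gamma> \<turnstile> EqTm M M' TyN \<Longrightarrow> \<Gamma> \<turnstile> EqTm N N' TyN \<Longrightarrow> \<Gamma> \<turnstile> EqProp (Eq M N) (Eq M' N')"
| seq_form: "\<Gamma> \<turnstile> HasType M TyN \<Longrightarrow> \<Gamma> \<turnstile> HasType N TyN \<Longrightarrow> \<Gamma> \<turnstile> IsSProp (SEq M N)"
| seq_cong: "\<Gamma> \<turnstile> EqTm M M' TyN \<Longrightarrow> \<Gamma> \<turnstile> EqTm N N' TyN \<Longrightarrow> \<Gamma> \<turnstile> EqSProp (SEq M N) (SEq M' N')"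
| V_eq: "\<Gamma> \<turnstile> HasType M TyN \<Longrightarrow> \<Gamma> \<turnstile> HasType N TyN \<Longrightarrow> \<Gamma> \<turnstile> EqProp (V (SEq M N)) (Eq M N)"

| botE: "\<Gamma> \<turnstile> Entails \<Phi> Bot \<Longrightarrow> \<Gamma> \<turnstile> IsProp \<phi> \<Longrightarrow> \<Gamma> \<turnstile> Entails \<Phi> \<phi>"
| impI: "\<Gamma> \<turnstile> Entails (\<phi> # \<Phi>) \<psi> \<Longrightarrow> \<Gamma> \<turnstile> Entails \<Phi> (Imp \<phi> \<psi>)"
| impE: "\<Gamma> \<turnstile> Entails \<Phi> (Imp \<phi> \<psi>) \<Longrightarrow> \<Gamma> \<turnstile> Entails \<Phi> \<phi> \<Longrightarrow> \<Gamma> \<turnstile> Entails \<Phi> \<psi>"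
| dne: "\<Gamma> \<turnstile> Entails \<Phi> (Neg (Neg \<phi>)) \<Longrightarrow> \<Gamma> \<turnstile> Entails \<Phi> \<phi>"
| allI: "\<forall>\<psi>\<in>set \<Phi>. \<Gamma> \<turnstile> IsProp \<psi> \<Longrightarrow> A # \<Gamma> \<turnstile> Entails (map lprop_lift \<Phi>) \<phi> \<Longrightarrow>
    \<Gamma> \<turnstile> Entails \<Phi> (All A \<phi>)"
| allE: "\<Gamma> \<turnstile> Entails \<Phi> (All A \<phi>) \<Longrightarrow> \<Gamma> \<turnstile> HasType M A \<Longrightarrow> \<Gamma> \<turnstile> Entails \<Phi> (lprop_inst M \<phi>)"
| eq_refl: "\<forall>\<psi>\<in>set \<Phi>. \<Gamma> \<turnstile> IsProp \<psi> \<Longrightarrow> \<Gamma> \<turnstile> HasType M TyN \<Longrightarrow> \<Gamma> \<turnstile> Entails \<Phi> (Eq M M)"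
| eq_subst: "TyN # \<Gamma> \<turnstile> IsProp \<phi> \<Longrightarrow> \<Gamma> \<turnstile> Entails \<Phi> (Eq M N) \<Longrightarrow>
    \<Gamma> \<turnstile> Entails \<Phi> (lprop_inst M \<phi>) \<Longrightarrow> \<Gamma> \<turnstile> Entails \<Phi> (lprop_inst N \<phi>)"
| ind: "TyN # \<Gamma> \<turnstile> IsSProp P \<Longrightarrow> \<Gamma> \<turnstile> HasType N TyN \<Longrightarrow>
    \<Gamma> \<turnstile> Entails \<Phi> (V (sprop_inst Zero P)) \<Longrightarrow>
    TyN # \<Gamma> \<turnstile> Entails (V P # map lprop_lift \<Phi>)
      (V (sprop_subst (case_nat (Succ (Var 0)) (\<lambda>x. Var (Suc x))) P)) \<Longrightarrow>
    \<Gamma> \<turnstile> Entails \<Phi> (V (sprop_inst N P))"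
| zero_neq_succ: "\<forall>\<psi>\<in>set \<Phi>. \<Gamma> \<turnstile> IsProp \<psi> \<Longrightarrow> \<Gamma> \<turnstile> HasType M TyN \<Longrightarrow>
    \<Gamma> \<turnstile> Entails \<Phi> (Neg (Eq Zero (Succ M)))"

section \<open>The translation\<close>

definition plus_tm :: "tm \<Rightarrow> tm \<Rightarrow> tm" where
  "plus_tm M N = Rec M (Succ (Var 0)) N"

definition times_tm :: "tm \<Rightarrow> tm \<Rightarrow> tm" where
  "times_tm M N = Rec Zero (plus_tm (Var 0) (tm_ren (\<lambda>x. Suc (Suc x)) M)) N"

text \<open>
  The arguments \<open>r\<close> and \<open>q\<close> say which variables of the type theory stand for the number variables
  and the set variables of the formula. A bound variable of either sort takes up an index of the
  single index space of the type theory, and so shifts the variables of both sorts.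
\<close>

primrec trans_tm :: "(nat \<Rightarrow> nat) \<Rightarrow> ltm \<Rightarrow> tm" where
  "trans_tm r (LVar x) = Var (r x)"
| "trans_tm r LZero = Zero"
| "trans_tm r (LSuc t) = Succ (trans_tm r t)"
| "trans_tm r (LPlus s t) = plus_tm (trans_tm r s) (trans_tm r t)"
| "trans_tm r (LTimes s t) = times_tm (trans_tm r s) (trans_tm r t)"

primrec trans_fm :: "(nat \<Rightarrow> nat) \<Rightarrow> (nat \<Rightarrow> nat) \<Rightarrow> lfm \<Rightarrow> lprop" where
  "trans_fm r q (LEq s t) = Eq (trans_tm r s) (trans_tm r t)"
| "trans_fm r q (LMem t X) = Mem (trans_tm r t) (Var (q X))"
| "trans_fm r q LBot = Bot"
| "trans_fm r q (LImp \<phi> \<psi>) = Imp (trans_fm r q \<phi>) (trans_fm r q \<psi>)"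
| "trans_fm r q (LAllN \<phi>) = All TyN (trans_fm (ren_up r) (\<lambda>X. Suc (q X)) \<phi>)"
| "trans_fm r q (LAllS \<phi>) = All TySetN (trans_fm (\<lambda>x. Suc (r x)) (ren_up q) \<phi>)"

text \<open>
  For number variables \<open>xs\<close> = $x_1,\dots,x_m$ and set variables \<open>Xs\<close> = $X_1,\dots,X_n$, in order of
  declaration: the context $x_1 : N, \dots, x_m : N, X_1 : Set(N), \dots, X_n : Set(N)$, and the
  translation sending each of these variables to its index in that context.
\<close>

definition ctx :: "nat list \<Rightarrow> nat list \<Rightarrow> ty list" where
  "ctx xs Xs = rev (map (\<lambda>_. TyN) xs @ map (\<lambda>_. TySetN) Xs)"

primrec position :: "nat list \<Rightarrow> nat \<Rightarrow> nat" where
  "position [] x = 0"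
| "position (y # ys) x = (if x = y then 0 else Suc (position ys x))"

definition translation :: "nat list \<Rightarrow> nat list \<Rightarrow> lfm \<Rightarrow> lprop" where
  "translation xs Xs =
    trans_fm (\<lambda>x. length Xs + position (rev xs) x) (\<lambda>X. position (rev Xs) X)"

end

theory Submission
  imports Defs
begin

text \<open>
  Formulas are interpreted in the type theory under environments that assign an arbitrary term of
  the right type to every variable, so that quantifier elimination and the equality rule of
  second order arithmetic become instances of substitution in the environment. Every rule of the
  calculus is sound for this interpretation in every context. The theorem is the special case in
  which the declared variables denote themselves and all other variables, which may well occur in
  an $ACA_0$ derivation of \<open>\<phi>\<close>, denote fixed closed terms. Comprehension holds because an
  arithmetic formula is judgementally equal to \<open>V P\<close> for a small proposition \<open>P\<close>; injectivity of
  the successor comes from a predecessor function defined by recursion.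
\<close>

section \<open>Substitution calculus\<close>

lemma ren_up_comp: "(\<lambda>x. ren_up r (ren_up s x)) = ren_up (\<lambda>x. r (s x))"
  by (rule ext) (simp add: ren_up_def split: nat.split)

lemma tm_up_Var: "tm_up (\<lambda>x. Var (r x)) = (\<lambda>x. Var (ren_up r x))"
  by (rule ext) (simp add: tm_up_def ren_up_def split: nat.split)

lemma ren_up_id: "ren_up (\<lambda>x. x) = (\<lambda>x. x)"
  by (rule ext) (simp add: ren_up_def split: nat.split)

lemma ren_eq_subst:
  "tm_ren r M = tm_subst (\<lambda>x. Var (r x)) M"
  "sprop_ren r P = sprop_subst (\<lambda>x. Var (r x)) P"
  by (induction M and P arbitrary: r and r) (simp_all add: tm_up_Var)

lemma subst_Var [simp]:
  "tm_subst Var M = M"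
  "sprop_subst Var P = P"
proof -
  have up: "tm_up Var = Var"
    using tm_up_Var[of "\<lambda>x. x"] by (simp add: ren_up_id)
  show "tm_subst Var M = M" "sprop_subst Var P = P"
    by (induction M and P) (simp_all add: up)
qed

lemma tm_up_ren: "(\<lambda>x. tm_up f (ren_up r x)) = tm_up (\<lambda>x. f (r x))"
  by (rule ext) (simp add: tm_up_def ren_up_def split: nat.split)

text \<open>The four fusion laws come in this order because carrying one under a binder, by its
  companion law for \<open>tm_up\<close>, uses earlier ones: \<open>ren_subst\<close> needs
  \<open>ren_ren\<close>, and \<open>subst_subst\<close> needs \<open>subst_ren\<close> and
  \<open>ren_subst\<close>.\<close>

lemma subst_ren:
  "tm_subst f (tm_ren r M) = tm_subst (\<lambda>x. f (r x)) M"
  "sprop_subst f (sprop_ren r P) = sprop_subst (\<lambda>x. f (r x)) P"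
  by (induction M and P arbitrary: f r and f r) (simp_all add: tm_up_ren)

lemma ren_ren:
  "tm_ren f (tm_ren r M) = tm_ren (\<lambda>x. f (r x)) M"
  "sprop_ren f (sprop_ren r P) = sprop_ren (\<lambda>x. f (r x)) P"
  by (induction M and P arbitrary: f r and f r) (simp_all add: ren_up_comp)

lemma ren_tm_up: "(\<lambda>x. tm_ren (ren_up r) (tm_up f x)) = tm_up (\<lambda>x. tm_ren r (f x))"
  by (rule ext) (simp add: tm_up_def ren_up_def ren_ren split: nat.split)

lemma ren_subst:
  "tm_ren r (tm_subst f M) = tm_subst (\<lambda>x. tm_ren r (f x)) M"
  "sprop_ren r (sprop_subst f P) = sprop_subst (\<lambda>x. tm_ren r (f x)) P"
  by (induction M and P arbitrary: f r and f r) (simp_all add: ren_tm_up)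

lemma subst_tm_up: "(\<lambda>x. tm_subst (tm_up f) (tm_up g x)) = tm_up (\<lambda>x. tm_subst f (g x))"
  by (rule ext) (simp add: tm_up_def subst_ren ren_subst split: nat.split)

lemma subst_subst:
  "tm_subst f (tm_subst g M) = tm_subst (\<lambda>x. tm_subst f (g x)) M"
  "sprop_subst f (sprop_subst g P) = sprop_subst (\<lambda>x. tm_subst f (g x)) P"
  by (induction M and P arbitrary: f g and f g) (simp_all add: subst_tm_up)

lemma subst_up_shift: "tm_subst (tm_up f) (tm_ren Suc M) = tm_ren Suc (tm_subst f M)"
  by (simp add: subst_ren ren_subst tm_up_def)

lemma subst_plus_tm [simp]: "tm_subst f (plus_tm M N) = plus_tm (tm_subst f M) (tm_subst f N)"
  by (simp add: plus_tm_def tm_up_def)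

lemma subst_times_tm [simp]: "tm_subst f (times_tm M N) = times_tm (tm_subst f M) (tm_subst f N)"
  by (simp add: times_tm_def tm_up_def subst_ren ren_subst ren_ren)

section \<open>Syntax-directed typing\<close>

text \<open>A recursive check that implies derivability in \<open>T2\<close>. It lets simplification
  settle typing premises, and weakening follows by induction on syntax instead of on
  derivations.\<close>

primrec wt_tm :: "tm \<Rightarrow> ty list \<Rightarrow> ty \<Rightarrow> bool" and wf_sprop :: "sprop \<Rightarrow> ty list \<Rightarrow> bool" where
  "wt_tm (Var i) \<Gamma> A = (i < length \<Gamma> \<and> \<Gamma> ! i = A)"
| "wt_tm Zero \<Gamma> A = (A = TyN)"
| "wt_tm (Succ M) \<Gamma> A = (A = TyN \<and> wt_tm M \<Gamma> TyN)"
| "wt_tm (Rec L M N) \<Gamma> A =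
    (A = TyN \<and> wt_tm L \<Gamma> TyN \<and> wt_tm M (TyN # TyN # \<Gamma>) TyN \<and> wt_tm N \<Gamma> TyN)"
| "wt_tm (Compr P) \<Gamma> A = (A = TySetN \<and> wf_sprop P (TyN # \<Gamma>))"
| "wf_sprop (SEq M N) \<Gamma> = (wt_tm M \<Gamma> TyN \<and> wt_tm N \<Gamma> TyN)"
| "wf_sprop SBot \<Gamma> = True"
| "wf_sprop (SImp P Q) \<Gamma> = (wf_sprop P \<Gamma> \<and> wf_sprop Q \<Gamma>)"
| "wf_sprop (SAll P) \<Gamma> = wf_sprop P (TyN # \<Gamma>)"
| "wf_sprop (SMem M N) \<Gamma> = (wt_tm M \<Gamma> TyN \<and> wt_tm N \<Gamma> TySetN)"

primrec wf_lprop :: "lprop \<Rightarrow> ty list \<Rightarrow> bool" where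
  "wf_lprop (Eq M N) \<Gamma> = (wt_tm M \<Gamma> TyN \<and> wt_tm N \<Gamma> TyN)"
| "wf_lprop Bot \<Gamma> = True"
| "wf_lprop (Imp \<phi> \<psi>) \<Gamma> = (wf_lprop \<phi> \<Gamma> \<and> wf_lprop \<psi> \<Gamma>)"
| "wf_lprop (All A \<phi>) \<Gamma> = wf_lprop \<phi> (A # \<Gamma>)"
| "wf_lprop (V P) \<Gamma> = wf_sprop P \<Gamma>"

text \<open>Types contain no terms, so each of the two can be formed over any context.\<close>

lemma ctx_valid: "\<Gamma> \<turnstile> Valid"
proof (induction \<Gamma>)
  case Nil
  show ?case by (rule T2.ctx_empty)
next
  case (Cons A \<Gamma>)
  then show ?case by (cases A) (auto intro: T2.ctx_ext T2.N_form T2.Set_form)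
qed

lemma is_type: "\<Gamma> \<turnstile> IsType A"
  by (cases A) (auto intro: T2.N_form T2.Set_form ctx_valid)

lemma wt_imp_T2:
  "wt_tm M \<Gamma> A \<Longrightarrow> \<Gamma> \<turnstile> HasType M A"
  "wf_sprop P \<Gamma> \<Longrightarrow> \<Gamma> \<turnstile> IsSProp P"
  by (induction M and P arbitrary: \<Gamma> A and \<Gamma>)
    (auto intro: T2.var T2.zero T2.succ T2.rec T2.compr T2.seq_form T2.sbot_form T2.simp_form
      T2.sall_form T2.smem_form ctx_valid)

lemma wf_imp_IsProp: "wf_lprop \<phi> \<Gamma> \<Longrightarrow> \<Gamma> \<turnstile> IsProp \<phi>"
  by (induction \<phi> arbitrary: \<Gamma>)
    (auto intro: T2.eq_form T2.bot_form T2.imp_form T2.all_form T2.V_form ctx_valid wt_imp_T2)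

section \<open>Renaming and weakening\<close>

definition ctx_ren :: "(nat \<Rightarrow> nat) \<Rightarrow> ty list \<Rightarrow> ty list \<Rightarrow> bool" where
  "ctx_ren r \<Gamma> \<Delta> \<longleftrightarrow> (\<forall>i<length \<Gamma>. r i < length \<Delta> \<and> \<Delta> ! r i = \<Gamma> ! i)"

lemma ctx_ren_up: "ctx_ren r \<Gamma> \<Delta> \<Longrightarrow> ctx_ren (ren_up r) (A # \<Gamma>) (A # \<Delta>)"
  by (auto simp: ctx_ren_def ren_up_def split: nat.split)

lemma wt_ren:
  "wt_tm M \<Gamma> A \<Longrightarrow> ctx_ren r \<Gamma> \<Delta> \<Longrightarrow> wt_tm (tm_ren r M) \<Delta> A"
  "wf_sprop P \<Gamma> \<Longrightarrow> ctx_ren r \<Gamma> \<Delta> \<Longrightarrow> wf_sprop (sprop_ren r P) \<Delta>"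
proof (induction M and P arbitrary: \<Gamma> \<Delta> A r and \<Gamma> \<Delta> r)
  case (Var x)
  then show ?case by (auto simp: ctx_ren_def)
next
  case (Rec L M N)
  then show ?case by simp (meson ctx_ren_up)
next
  case (Compr P)
  then show ?case by simp (meson ctx_ren_up)
next
  case (SAll P)
  then show ?case by simp (meson ctx_ren_up)
qed auto

lemma wt_shift: "wt_tm M \<Gamma> A \<Longrightarrow> wt_tm (tm_ren Suc M) (B # \<Gamma>) A"
  by (erule wt_ren) (simp add: ctx_ren_def)

lemma wt_plus_tm: "wt_tm M \<Gamma> TyN \<Longrightarrow> wt_tm N \<Gamma> TyN \<Longrightarrow> wt_tm (plus_tm M N) \<Gamma> TyN"
  by (simp add: plus_tm_def)

text \<open>Typed on its own because the computation rules of \<open>Rec\<close> have the typing of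
  the step as a premise.\<close>

lemma wt_times_step:
  "wt_tm M \<Gamma> TyN \<Longrightarrow>
    wt_tm (plus_tm (Var 0) (tm_ren (\<lambda>x. Suc (Suc x)) M)) (TyN # TyN # \<Gamma>) TyN"
  by (rule wt_plus_tm) (auto elim: wt_ren simp: ctx_ren_def)

lemma wt_times_tm: "wt_tm M \<Gamma> TyN \<Longrightarrow> wt_tm N \<Gamma> TyN \<Longrightarrow> wt_tm (times_tm M N) \<Gamma> TyN"
  by (simp add: times_tm_def wt_times_step)

section \<open>Interpretation of formulas under environments\<close>

primrec eval_tm :: "(nat \<Rightarrow> tm) \<Rightarrow> ltm \<Rightarrow> tm" where
  "eval_tm \<rho> (LVar x) = \<rho> x"
| "eval_tm \<rho> LZero = Zero"
| "eval_tm \<rho> (LSuc t) = Succ (eval_tm \<rho> t)"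
| "eval_tm \<rho> (LPlus s t) = plus_tm (eval_tm \<rho> s) (eval_tm \<rho> t)"
| "eval_tm \<rho> (LTimes s t) = times_tm (eval_tm \<rho> s) (eval_tm \<rho> t)"

primrec eval_fm :: "(nat \<Rightarrow> tm) \<Rightarrow> (nat \<Rightarrow> tm) \<Rightarrow> lfm \<Rightarrow> lprop" where
  "eval_fm \<rho> \<sigma> (LEq s t) = Eq (eval_tm \<rho> s) (eval_tm \<rho> t)"
| "eval_fm \<rho> \<sigma> (LMem t X) = Mem (eval_tm \<rho> t) (\<sigma> X)"
| "eval_fm \<rho> \<sigma> LBot = Bot"
| "eval_fm \<rho> \<sigma> (LImp \<phi> \<psi>) = Imp (eval_fm \<rho> \<sigma> \<phi>) (eval_fm \<rho> \<sigma> \<psi>)"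
| "eval_fm \<rho> \<sigma> (LAllN \<phi>) = All TyN (eval_fm (tm_up \<rho>) (\<lambda>X. tm_ren Suc (\<sigma> X)) \<phi>)"
| "eval_fm \<rho> \<sigma> (LAllS \<phi>) = All TySetN (eval_fm (\<lambda>x. tm_ren Suc (\<rho> x)) (tm_up \<sigma>) \<phi>)"

text \<open>Only meaningful for arithmetic formulas; the value at a set quantifier is junk.\<close>

primrec eval_sprop :: "(nat \<Rightarrow> tm) \<Rightarrow> (nat \<Rightarrow> tm) \<Rightarrow> lfm \<Rightarrow> sprop" where
  "eval_sprop \<rho> \<sigma> (LEq s t) = SEq (eval_tm \<rho> s) (eval_tm \<rho> t)"
| "eval_sprop \<rho> \<sigma> (LMem t X) = SMem (eval_tm \<rho> t) (\<sigma> X)"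
| "eval_sprop \<rho> \<sigma> LBot = SBot"
| "eval_sprop \<rho> \<sigma> (LImp \<phi> \<psi>) = SImp (eval_sprop \<rho> \<sigma> \<phi>) (eval_sprop \<rho> \<sigma> \<psi>)"
| "eval_sprop \<rho> \<sigma> (LAllN \<phi>) = SAll (eval_sprop (tm_up \<rho>) (\<lambda>X. tm_ren Suc (\<sigma> X)) \<phi>)"
| "eval_sprop \<rho> \<sigma> (LAllS \<phi>) = SBot"

lemma trans_tm_eq_eval: "trans_tm r t = eval_tm (\<lambda>x. Var (r x)) t"
  by (induction t) simp_all

lemma trans_fm_eq_eval: "trans_fm r q \<phi> = eval_fm (\<lambda>x. Var (r x)) (\<lambda>X. Var (q X)) \<phi>"
  by (induction \<phi> arbitrary: r q) (simp_all add: trans_tm_eq_eval tm_up_Var)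

lemma eval_tm_cong: "(\<And>x. x \<in> ltm_fv t \<Longrightarrow> \<rho> x = \<rho>' x) \<Longrightarrow> eval_tm \<rho> t = eval_tm \<rho>' t"
  by (induction t) simp_all

text \<open>Two changes of environment rely on it: giving closed values to undeclared variables, and
  exchanging the value of the fresh set variable in comprehension.\<close>

lemma eval_fm_cong:
  assumes "\<And>x. x \<in> num_fv \<phi> \<Longrightarrow> \<rho> x = \<rho>' x" and "\<And>X. X \<in> set_fv \<phi> \<Longrightarrow> \<sigma> X = \<sigma>' X"
  shows "eval_fm \<rho> \<sigma> \<phi> = eval_fm \<rho>' \<sigma>' \<phi>"
  using assms
proof (induction \<phi> arbitrary: \<rho> \<rho>' \<sigma> \<sigma>')
  case (LEq s t)
  then show ?case by (auto intro: eval_tm_cong)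
next
  case (LMem t X)
  then show ?case by (auto intro: eval_tm_cong)
next
  case LBot
  show ?case by simp
next
  case (LImp \<phi> \<psi>)
  have "eval_fm \<rho> \<sigma> \<phi> = eval_fm \<rho>' \<sigma>' \<phi>" by (rule LImp.IH(1)) (simp_all add: LImp.prems)
  moreover have "eval_fm \<rho> \<sigma> \<psi> = eval_fm \<rho>' \<sigma>' \<psi>"
    by (rule LImp.IH(2)) (simp_all add: LImp.prems)
  ultimately show ?case by simp
next
  case (LAllN \<phi>)
  have "eval_fm (tm_up \<rho>) (\<lambda>X. tm_ren Suc (\<sigma> X)) \<phi> = eval_fm (tm_up \<rho>') (\<lambda>X. tm_ren Suc (\<sigma>' X)) \<phi>"
    by (rule LAllN.IH) (auto simp: LAllN.prems tm_up_def split: nat.split)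
  then show ?case by simp
next
  case (LAllS \<phi>)
  have "eval_fm (\<lambda>x. tm_ren Suc (\<rho> x)) (tm_up \<sigma>) \<phi> = eval_fm (\<lambda>x. tm_ren Suc (\<rho>' x)) (tm_up \<sigma>') \<phi>"
    by (rule LAllS.IH) (auto simp: LAllS.prems tm_up_def split: nat.split)
  then show ?case by simp
qed

section \<open>Interpretation and substitution\<close>

lemma subst_eval_tm: "tm_subst f (eval_tm \<rho> t) = eval_tm (\<lambda>x. tm_subst f (\<rho> x)) t"
  by (induction t) simp_all

lemma ren_eval_tm: "tm_ren r (eval_tm \<rho> t) = eval_tm (\<lambda>x. tm_ren r (\<rho> x)) t"
  by (simp add: ren_eq_subst subst_eval_tm)

text \<open>Under a quantifier, the environment of the bound sort is handled by
  \<open>subst_tm_up\<close>; that of the other sort is merely shifted and is handled by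
  \<open>subst_up_shift\<close>.\<close>

lemma subst_eval_fm:
  "lprop_subst f (eval_fm \<rho> \<sigma> \<phi>) =
    eval_fm (\<lambda>x. tm_subst f (\<rho> x)) (\<lambda>X. tm_subst f (\<sigma> X)) \<phi>"
  by (induction \<phi> arbitrary: f \<rho> \<sigma>) (simp_all add: subst_eval_tm subst_tm_up subst_up_shift)

lemma lift_eval_fm:
  "lprop_lift (eval_fm \<rho> \<sigma> \<phi>) = eval_fm (\<lambda>x. tm_ren Suc (\<rho> x)) (\<lambda>X. tm_ren Suc (\<sigma> X)) \<phi>"
  by (simp add: subst_eval_fm ren_eq_subst)

lemma inst_up: "(\<lambda>x. tm_subst (case_nat M Var) (tm_up f x)) = case_nat M f"
  by (rule ext) (simp add: tm_up_def subst_ren split: nat.split)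

lemma inst_shift: "tm_subst (case_nat M Var) (tm_ren Suc N) = N"
  by (simp add: subst_ren)

lemma eval_ltm_subst: "eval_tm \<rho> (ltm_subst f t) = eval_tm (\<lambda>x. eval_tm \<rho> (f x)) t"
  by (induction t) simp_all

lemma eval_ltm_up: "(\<lambda>x. eval_tm (tm_up \<rho>) (ltm_up f x)) = tm_up (\<lambda>x. eval_tm \<rho> (f x))"
  by (rule ext) (simp add: tm_up_def ltm_up_def eval_ltm_subst ren_eval_tm split: nat.split)

lemma eval_num_subst:
  "eval_fm \<rho> \<sigma> (num_subst f \<phi>) = eval_fm (\<lambda>x. eval_tm \<rho> (f x)) \<sigma> \<phi>"
  by (induction \<phi> arbitrary: f \<rho> \<sigma>)
    (simp_all add: eval_ltm_subst eval_ltm_up ren_eval_tm)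

lemma eval_set_subst: "eval_fm \<rho> \<sigma> (set_subst r \<phi>) = eval_fm \<rho> (\<lambda>X. \<sigma> (r X)) \<phi>"
  by (induction \<phi> arbitrary: r \<rho> \<sigma>) (simp_all add: tm_up_ren)

text \<open>Both sides are the interpretation of \<open>\<phi>\<close> under \<open>\<rho>\<close>
  extended by the value of \<open>t\<close>. In this form, number quantifier elimination and
  rewriting along an equation match \<open>T2.allE\<close> and \<open>T2.eq_subst\<close>.\<close>

lemma eval_num_inst:
  "eval_fm \<rho> \<sigma> (num_inst t \<phi>) =
    lprop_inst (eval_tm \<rho> t) (eval_fm (tm_up \<rho>) (\<lambda>X. tm_ren Suc (\<sigma> X)) \<phi>)"
proof -
  have "(\<lambda>x. eval_tm \<rho> (case x of 0 \<Rightarrow> t | Suc y \<Rightarrow> LVar y)) = case_nat (eval_tm \<rho> t) \<rho>"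
    by (rule ext) (simp split: nat.split)
  then show ?thesis by (simp add: eval_num_subst subst_eval_fm inst_up inst_shift)
qed

lemma eval_set_inst:
  "eval_fm \<rho> \<sigma> (set_inst Y \<phi>) =
    lprop_inst (\<sigma> Y) (eval_fm (\<lambda>x. tm_ren Suc (\<rho> x)) (tm_up \<sigma>) \<phi>)"
proof -
  have "(\<lambda>X. \<sigma> (case X of 0 \<Rightarrow> Y | Suc Z \<Rightarrow> Z)) = case_nat (\<sigma> Y) \<sigma>"
    by (rule ext) (simp split: nat.split)
  then show ?thesis by (simp add: eval_set_subst subst_eval_fm inst_up inst_shift)
qed

text \<open>Every index needs a well-typed value, since a derivation may pass through formulas with
  arbitrary free variables.\<close>

definition wt_env :: "ty list \<Rightarrow> (nat \<Rightarrow> tm) \<Rightarrow> (nat \<Rightarrow> tm) \<Rightarrow> bool" where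
  "wt_env \<Gamma> \<rho> \<sigma> \<longleftrightarrow> (\<forall>x. wt_tm (\<rho> x) \<Gamma> TyN) \<and> (\<forall>X. wt_tm (\<sigma> X) \<Gamma> TySetN)"

lemma wt_env_upN: "wt_env \<Gamma> \<rho> \<sigma> \<Longrightarrow> wt_env (TyN # \<Gamma>) (tm_up \<rho>) (\<lambda>X. tm_ren Suc (\<sigma> X))"
  by (auto simp: wt_env_def tm_up_def wt_shift split: nat.split)

lemma wt_env_upS: "wt_env \<Gamma> \<rho> \<sigma> \<Longrightarrow> wt_env (TySetN # \<Gamma>) (\<lambda>x. tm_ren Suc (\<rho> x)) (tm_up \<sigma>)"
  by (auto simp: wt_env_def tm_up_def wt_shift split: nat.split)

lemma wt_eval_tm: "wt_env \<Gamma> \<rho> \<sigma> \<Longrightarrow> wt_tm (eval_tm \<rho> t) \<Gamma> TyN"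
  by (induction t) (simp_all add: wt_env_def wt_plus_tm wt_times_tm)

lemma wf_eval_fm: "wt_env \<Gamma> \<rho> \<sigma> \<Longrightarrow> wf_lprop (eval_fm \<rho> \<sigma> \<phi>) \<Gamma>"
  by (induction \<phi> arbitrary: \<Gamma> \<rho> \<sigma>)
    (auto simp: wt_eval_tm wt_env_upN wt_env_upS, simp add: wt_env_def)

lemma wf_eval_sprop: "wt_env \<Gamma> \<rho> \<sigma> \<Longrightarrow> wf_sprop (eval_sprop \<rho> \<sigma> \<phi>) \<Gamma>"
  by (induction \<phi> arbitrary: \<Gamma> \<rho> \<sigma>)
    (auto simp: wt_eval_tm wt_env_upN, simp add: wt_env_def)

text \<open>At each connective the computation rule for \<open>V\<close> applies. Membership is
  already of the form \<open>V P\<close>, and set quantifiers, which have no small counterpart, are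
  excluded by \<open>arithmetic\<close>.\<close>

lemma V_eval_sprop:
  assumes "arithmetic \<phi>" "wt_env \<Gamma> \<rho> \<sigma>"
  shows "\<Gamma> \<turnstile> EqProp (V (eval_sprop \<rho> \<sigma> \<phi>)) (eval_fm \<rho> \<sigma> \<phi>)"
  using assms
proof (induction \<phi> arbitrary: \<Gamma> \<rho> \<sigma>)
  case (LEq s t)
  then show ?case by (simp add: T2.V_eq wt_imp_T2 wt_eval_tm)
next
  case (LMem t X)
  from LMem.prems(2) have "wf_lprop (eval_fm \<rho> \<sigma> (LMem t X)) \<Gamma>" by (rule wf_eval_fm)
  then show ?case using T2.prop_refl wf_imp_IsProp by fastforce
next
  case LBot
  show ?case by (simp add: T2.V_bot ctx_valid)
next
  case (LImp \<phi> \<psi>)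
  have "\<Gamma> \<turnstile> EqProp (V (eval_sprop \<rho> \<sigma> (LImp \<phi> \<psi>)))
      (Imp (V (eval_sprop \<rho> \<sigma> \<phi>)) (V (eval_sprop \<rho> \<sigma> \<psi>)))"
    using LImp.prems by (simp add: T2.V_imp wt_imp_T2 wf_eval_sprop)
  moreover have "\<Gamma> \<turnstile> EqProp (Imp (V (eval_sprop \<rho> \<sigma> \<phi>)) (V (eval_sprop \<rho> \<sigma> \<psi>)))
      (eval_fm \<rho> \<sigma> (LImp \<phi> \<psi>))"
    using LImp by (simp add: T2.imp_cong)
  ultimately show ?case by (rule T2.prop_trans)
next
  case (LAllN \<phi>)
  let ?\<rho> = "tm_up \<rho>" and ?\<sigma> = "\<lambda>X. tm_ren Suc (\<sigma> X)"
  have env: "wt_env (TyN # \<Gamma>) ?\<rho> ?\<sigma>" using LAllN.prems by (simp add: wt_env_upN)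
  have "\<Gamma> \<turnstile> EqProp (V (eval_sprop \<rho> \<sigma> (LAllN \<phi>))) (All TyN (V (eval_sprop ?\<rho> ?\<sigma> \<phi>)))"
    using env by (simp add: T2.V_all wt_imp_T2 wf_eval_sprop)
  moreover have "\<Gamma> \<turnstile> EqProp (All TyN (V (eval_sprop ?\<rho> ?\<sigma> \<phi>))) (eval_fm \<rho> \<sigma> (LAllN \<phi>))"
    using env LAllN by (simp add: T2.all_cong T2.type_refl is_type)
  ultimately show ?case by (rule T2.prop_trans)
qed simp

section \<open>Derived rules of the type theory\<close>

text \<open>The premise that \<open>T2.hyp\<close>, \<open>T2.allI\<close>,
  \<open>T2.eq_refl\<close> and \<open>T2.zero_neq_succ\<close> put on their hypotheses.\<close>

definition wf_hyps :: "ty list \<Rightarrow> lprop list \<Rightarrow> bool" where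
  "wf_hyps \<Gamma> \<Phi> \<longleftrightarrow> (\<forall>\<psi>\<in>set \<Phi>. \<Gamma> \<turnstile> IsProp \<psi>)"

lemma wf_hyps_Cons: "wf_hyps \<Gamma> \<Phi> \<Longrightarrow> \<Gamma> \<turnstile> IsProp \<phi> \<Longrightarrow> wf_hyps \<Gamma> (\<phi> # \<Phi>)"
  by (simp add: wf_hyps_def)

lemma wf_hyps_eval: "wt_env \<Gamma> \<rho> \<sigma> \<Longrightarrow> wf_hyps \<Gamma> (map (eval_fm \<rho> \<sigma>) \<Phi>)"
  by (simp add: wf_hyps_def wf_imp_IsProp wf_eval_fm)

lemma entails_hyp: "wf_hyps \<Gamma> \<Phi> \<Longrightarrow> \<phi> \<in> set \<Phi> \<Longrightarrow> \<Gamma> \<turnstile> Entails \<Phi> \<phi>"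
  by (rule T2.hyp) (simp_all add: wf_hyps_def)

text \<open>Congruence makes \<open>Eq M M\<close> and \<open>Eq M N\<close> equal propositions, so
  reflexivity converts to the latter.\<close>

lemma entails_EqTm:
  assumes "wf_hyps \<Gamma> \<Phi>" "wt_tm M \<Gamma> TyN" "\<Gamma> \<turnstile> EqTm M N TyN"
  shows "\<Gamma> \<turnstile> Entails \<Phi> (Eq M N)"
proof (rule T2.entails_conv)
  show "\<Gamma> \<turnstile> Entails \<Phi> (Eq M M)"
    using assms by (intro T2.eq_refl) (simp_all add: wf_hyps_def wt_imp_T2)
  show "\<Gamma> \<turnstile> EqProp (Eq M M) (Eq M N)"
    using assms by (intro T2.eq_cong T2.tm_refl wt_imp_T2)
qed

text \<open>Rewrites along the equation in the predicate "equal to \<open>M\<close>", which holds of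
  \<open>M\<close> by reflexivity. It serves to reverse the axiom that zero is not a
  successor.\<close>

lemma entails_sym:
  assumes "wf_hyps \<Gamma> \<Phi>" "wt_tm M \<Gamma> TyN" "\<Gamma> \<turnstile> Entails \<Phi> (Eq M N)"
  shows "\<Gamma> \<turnstile> Entails \<Phi> (Eq N M)"
proof -
  let ?\<phi> = "Eq (Var 0) (tm_ren Suc M)"
  have "TyN # \<Gamma> \<turnstile> IsProp ?\<phi>" using assms by (simp add: wf_imp_IsProp wt_shift)
  moreover have "\<Gamma> \<turnstile> Entails \<Phi> (lprop_inst M ?\<phi>)"
    using assms by (simp add: inst_shift entails_EqTm T2.tm_refl wt_imp_T2)
  ultimately have "\<Gamma> \<turnstile> Entails \<Phi> (lprop_inst N ?\<phi>)" using assms(3) by (blast intro: T2.eq_subst)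
  then show ?thesis by (simp add: inst_shift)
qed

section \<open>Peano axioms for zero and successor\<close>

lemma succ_neq_zero:
  assumes "wf_hyps \<Gamma> \<Phi>" "wt_tm M \<Gamma> TyN"
  shows "\<Gamma> \<turnstile> Entails \<Phi> (Neg (Eq (Succ M) Zero))"
proof (rule T2.impI)
  let ?\<Phi> = "Eq (Succ M) Zero # \<Phi>"
  have wf: "wf_hyps \<Gamma> ?\<Phi>" using assms by (simp add: wf_hyps_Cons wf_imp_IsProp)
  have "\<Gamma> \<turnstile> Entails ?\<Phi> (Eq Zero (Succ M))"
    using assms by (intro entails_sym[OF wf _ entails_hyp[OF wf]]) simp_all
  moreover have "\<Gamma> \<turnstile> Entails ?\<Phi> (Neg (Eq Zero (Succ M)))"
    using wf assms by (intro T2.zero_neq_succ) (simp_all add: wf_hyps_def wt_imp_T2)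
  ultimately show "\<Gamma> \<turnstile> Entails ?\<Phi> Bot" by (rule T2.impE[rotated])
qed

text \<open>In the step of \<open>Rec\<close>, index 1 is the predecessor and index 0 the recursive
  value, so this is the predecessor function, with value \<open>Zero\<close> at zero.\<close>

definition pred_tm :: "tm \<Rightarrow> tm" where
  "pred_tm M = Rec Zero (Var 1) M"

lemma pred_succ:
  assumes "wt_tm M \<Gamma> TyN"
  shows "\<Gamma> \<turnstile> EqTm (pred_tm (Succ M)) M TyN"
  using T2.rec_succ[of \<Gamma> Zero "Var 1" M] assms by (simp add: pred_tm_def wt_imp_T2)

text \<open>The predicate "\<open>M\<close> equals the predecessor of \<open>x\<close>" holds at
  \<open>Succ M\<close> by computation. Rewriting along the hypothesis gives it at
  \<open>Succ N\<close>, whose predecessor computes to \<open>N\<close>.\<close>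

lemma succ_injective:
  assumes "wf_hyps \<Gamma> \<Phi>" "wt_tm M \<Gamma> TyN" "wt_tm N \<Gamma> TyN"
  shows "\<Gamma> \<turnstile> Entails \<Phi> (Imp (Eq (Succ M) (Succ N)) (Eq M N))"
proof (rule T2.impI)
  let ?\<Phi> = "Eq (Succ M) (Succ N) # \<Phi>" and ?\<phi> = "Eq (tm_ren Suc M) (pred_tm (Var 0))"
  have wf: "wf_hyps \<Gamma> ?\<Phi>" using assms by (simp add: wf_hyps_Cons wf_imp_IsProp)
  have inst: "lprop_inst K ?\<phi> = Eq M (pred_tm K)" for K
    by (simp add: inst_shift pred_tm_def tm_up_def)
  have "TyN # \<Gamma> \<turnstile> IsProp ?\<phi>" using assms by (simp add: wf_imp_IsProp wt_shift pred_tm_def)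
  moreover have "\<Gamma> \<turnstile> Entails ?\<Phi> (Eq (Succ M) (Succ N))" using wf by (rule entails_hyp) simp
  moreover have "\<Gamma> \<turnstile> Entails ?\<Phi> (lprop_inst (Succ M) ?\<phi>)"
    unfolding inst using wf assms by (intro entails_EqTm T2.tm_sym[OF pred_succ])
  ultimately have "\<Gamma> \<turnstile> Entails ?\<Phi> (lprop_inst (Succ N) ?\<phi>)" by (rule T2.eq_subst)
  then show "\<Gamma> \<turnstile> Entails ?\<Phi> (Eq M N)" unfolding inst
    using assms by (elim T2.entails_conv) (intro T2.eq_cong T2.tm_refl pred_succ wt_imp_T2)
qed

text \<open>Addition and multiplication recurse on the second argument, as in the axioms of second
  order arithmetic, so those axioms already hold judgementally.\<close>

lemma plus_tm_zero: "wt_tm M \<Gamma> TyN \<Longrightarrow> \<Gamma> \<turnstile> EqTm (plus_tm M Zero) M TyN"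
  unfolding plus_tm_def by (rule T2.rec_zero) (simp_all add: wt_imp_T2)

lemma plus_tm_succ:
  assumes "wt_tm M \<Gamma> TyN" "wt_tm N \<Gamma> TyN"
  shows "\<Gamma> \<turnstile> EqTm (plus_tm M (Succ N)) (Succ (plus_tm M N)) TyN"
  using T2.rec_succ[of \<Gamma> M "Succ (Var 0)" N] assms by (simp add: plus_tm_def wt_imp_T2)

lemma times_tm_zero: "wt_tm M \<Gamma> TyN \<Longrightarrow> \<Gamma> \<turnstile> EqTm (times_tm M Zero) Zero TyN"
  unfolding times_tm_def by (rule T2.rec_zero) (simp_all add: wt_imp_T2 wt_times_step)

text \<open>The step contains \<open>M\<close> shifted past its two bound variables; instantiating
  them undoes the shift.\<close>

lemma times_tm_succ:
  assumes "wt_tm M \<Gamma> TyN" "wt_tm N \<Gamma> TyN"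
  shows "\<Gamma> \<turnstile> EqTm (times_tm M (Succ N)) (plus_tm (times_tm M N) M) TyN"
  using T2.rec_succ[of \<Gamma> Zero "plus_tm (Var 0) (tm_ren (\<lambda>x. Suc (Suc x)) M)" N] assms
  by (simp add: times_tm_def wt_imp_T2 wt_times_step subst_ren)

text \<open>The conclusion is the classical coding of a biconditional. Equal propositions imply each
  other, which refutes \<open>?h\<close>.\<close>

lemma entails_iff_of_EqProp:
  assumes eq: "\<Gamma> \<turnstile> EqProp \<phi> \<psi>" and wf: "wf_hyps \<Gamma> \<Phi>" "wf_lprop \<phi> \<Gamma>" "wf_lprop \<psi> \<Gamma>"
  shows "\<Gamma> \<turnstile> Entails \<Phi> (Neg (Imp (Imp \<phi> \<psi>) (Neg (Imp \<psi> \<phi>))))"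
proof (rule T2.impI)
  let ?h = "Imp (Imp \<phi> \<psi>) (Neg (Imp \<psi> \<phi>))"
  have wfh: "wf_hyps \<Gamma> (?h # \<Phi>)" using wf by (simp add: wf_hyps_Cons wf_imp_IsProp)
  \<comment> \<open>The assumption \<open>\<alpha>\<close> itself converts to
    \<open>\<beta>\<close>.\<close>
  have imp: "\<Gamma> \<turnstile> Entails (?h # \<Phi>) (Imp \<alpha> \<beta>)" if "\<Gamma> \<turnstile> EqProp \<alpha> \<beta>" "wf_lprop \<alpha> \<Gamma>" for \<alpha> \<beta>
    using that wfh
    by (intro T2.impI T2.entails_conv[OF _ that(1)] entails_hyp) (simp_all add: wf_hyps_Cons wf_imp_IsProp)
  have "\<Gamma> \<turnstile> Entails (?h # \<Phi>) ?h" using wfh by (rule entails_hyp) simp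
  then have "\<Gamma> \<turnstile> Entails (?h # \<Phi>) (Neg (Imp \<psi> \<phi>))" using imp[OF eq wf(2)] by (rule T2.impE)
  then show "\<Gamma> \<turnstile> Entails (?h # \<Phi>) Bot" using imp[OF T2.prop_sym[OF eq] wf(3)] by (rule T2.impE)
qed

section \<open>Soundness of the interpretation\<close>

text \<open>Existence is a negated universal statement, so the assumption \<open>?H\<close> that no
  set works is instantiated at an explicit \<open>Compr P\<close> and contradicted.\<close>

lemma comprehension_sound:
  assumes ar: "arithmetic \<phi>" and fv: "0 \<notin> set_fv \<phi>" and env: "wt_env \<Gamma> \<rho> \<sigma>"
  shows "\<Gamma> \<turnstile> Entails (map (eval_fm \<rho> \<sigma>) \<Phi>)
    (eval_fm \<rho> \<sigma> (LExS (LAllN (LIff (LMem (LVar 0) 0) \<phi>))))"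
proof -
  let ?iff = "LIff (LMem (LVar 0) 0) \<phi>"
  let ?H = "eval_fm \<rho> \<sigma> (LAllS (LNeg (LAllN ?iff)))"
  let ?\<Phi> = "?H # map (eval_fm \<rho> \<sigma>) \<Phi>"
  define \<rho>' where "\<rho>' = tm_up \<rho>"
  \<comment> \<open>Avoids a circularity: the witness is built from the interpretation of
    \<open>\<phi>\<close>, which itself asks for a value at set index 0. The empty set stands there
    provisionally.\<close>
  define \<sigma>0 where "\<sigma>0 = (\<lambda>X. tm_ren Suc (case_nat (Compr SBot) \<sigma> X))"
  define P where "P = eval_sprop \<rho>' \<sigma>0 \<phi>"
  \<comment> \<open>The set environment below the number quantifier once \<open>X\<close> has the
    true witness as its value.\<close>
  define \<sigma>' where "\<sigma>' = (\<lambda>X. tm_ren Suc (case_nat (Compr P) \<sigma> X))"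
  have env0: "wt_env (TyN # \<Gamma>) \<rho>' \<sigma>0"
    unfolding \<rho>'_def \<sigma>0_def using env
    by (intro wt_env_upN) (simp add: wt_env_def split: nat.split)
  have wfP: "wf_sprop P (TyN # \<Gamma>)" unfolding P_def using env0 by (rule wf_eval_sprop)
  have env1: "wt_env \<Gamma> \<rho> (case_nat (Compr P) \<sigma>)"
    using env wfP by (simp add: wt_env_def split: nat.split)
  have env': "wt_env (TyN # \<Gamma>) \<rho>' \<sigma>'" unfolding \<rho>'_def \<sigma>'_def using env1 by (rule wt_env_upN)
  have wf: "wf_hyps \<Gamma> ?\<Phi>"
    using env by (intro wf_hyps_Cons wf_hyps_eval wf_imp_IsProp wf_eval_fm)
  have wf': "wf_hyps (TyN # \<Gamma>) (map lprop_lift ?\<Phi>)"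
  proof -
    \<comment> \<open>Lifted hypotheses are the same formulas interpreted in shifted environments,
      hence well formed.\<close>
    have "wt_env (TyN # \<Gamma>) (\<lambda>x. tm_ren Suc (\<rho> x)) (\<lambda>X. tm_ren Suc (\<sigma> X))"
      using env by (simp add: wt_env_def wt_shift)
    then show ?thesis
      by (simp only: wf_hyps_def list.map map_map o_def lift_eval_fm)
        (auto intro!: wf_imp_IsProp wf_eval_fm simp del: eval_fm.simps)
  qed
  \<comment> \<open>Below the number quantifier the witness occurs shifted. Membership of
    \<open>Var 0\<close> in it unfolds to the shifted \<open>P\<close> with its bound variable
    replaced by \<open>Var 0\<close>, which is \<open>P\<close> again.\<close>
  have "TyN # \<Gamma> \<turnstile> EqSProp (SMem (Var 0) (Compr (sprop_ren (ren_up Suc) P)))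
      (sprop_inst (Var 0) (sprop_ren (ren_up Suc) P))"
  proof (rule T2.smem_compr)
    have "ctx_ren (ren_up Suc) (TyN # \<Gamma>) (TyN # TyN # \<Gamma>)"
      by (rule ctx_ren_up) (simp add: ctx_ren_def)
    with wfP show "TyN # TyN # \<Gamma> \<turnstile> IsSProp (sprop_ren (ren_up Suc) P)"
      by (blast intro: wt_imp_T2 wt_ren)
  qed (simp add: wt_imp_T2)
  moreover have "sprop_inst (Var 0) (sprop_ren (ren_up Suc) P) = P"
  proof -
    have "(\<lambda>x. case ren_up Suc x of 0 \<Rightarrow> Var 0 | Suc y \<Rightarrow> Var y) = Var"
      by (rule ext) (simp add: ren_up_def split: nat.split)
    then show ?thesis by (simp add: subst_ren)
  qed
  ultimately have "TyN # \<Gamma> \<turnstile> EqProp (Mem (Var 0) (tm_ren Suc (Compr P))) (V P)"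
    by (simp add: T2.V_cong)
  moreover have "TyN # \<Gamma> \<turnstile> EqProp (V P) (eval_fm \<rho>' \<sigma>0 \<phi>)"
    unfolding P_def using ar env0 by (rule V_eval_sprop)
  \<comment> \<open>\<open>\<sigma>0\<close> and \<open>\<sigma>'\<close> differ only at index 0,
    which is not free in \<open>\<phi>\<close>, so the witness can replace the provisional
    value.\<close>
  moreover have "eval_fm \<rho>' \<sigma>0 \<phi> = eval_fm \<rho>' \<sigma>' \<phi>"
    using fv by (intro eval_fm_cong) (auto simp: \<sigma>0_def \<sigma>'_def gr0_conv_Suc split: nat.split)
  ultimately have eq: "TyN # \<Gamma> \<turnstile> EqProp (eval_fm \<rho>' \<sigma>' (LMem (LVar 0) 0)) (eval_fm \<rho>' \<sigma>' \<phi>)"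
    by (simp add: \<rho>'_def \<sigma>'_def tm_up_def del: tm_ren.simps) (rule T2.prop_trans)
  have "TyN # \<Gamma> \<turnstile> Entails (map lprop_lift ?\<Phi>) (eval_fm \<rho>' \<sigma>' ?iff)"
    using entails_iff_of_EqProp[OF eq wf' wf_eval_fm[OF env'] wf_eval_fm[OF env']] by simp
  then have all: "\<Gamma> \<turnstile> Entails ?\<Phi> (eval_fm \<rho> (case_nat (Compr P) \<sigma>) (LAllN ?iff))"
    using wf unfolding eval_fm.simps(5) \<rho>'_def \<sigma>'_def by (intro T2.allI) (simp_all add: wf_hyps_def)
  have "\<Gamma> \<turnstile> Entails ?\<Phi> (All TySetN (eval_fm (\<lambda>x. tm_ren Suc (\<rho> x)) (tm_up \<sigma>) (LNeg (LAllN ?iff))))"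
    using wf by (rule entails_hyp) simp
  then have "\<Gamma> \<turnstile> Entails ?\<Phi>
      (lprop_inst (Compr P) (eval_fm (\<lambda>x. tm_ren Suc (\<rho> x)) (tm_up \<sigma>) (LNeg (LAllN ?iff))))"
    by (rule T2.allE) (simp add: wt_imp_T2 wfP)
  then have "\<Gamma> \<turnstile> Entails ?\<Phi> (Neg (eval_fm \<rho> (case_nat (Compr P) \<sigma>) (LAllN ?iff)))"
    by (simp only: subst_eval_fm inst_up inst_shift eval_fm.simps(3,4) lprop_subst.simps)
  then have "\<Gamma> \<turnstile> Entails ?\<Phi> Bot" using all by (rule T2.impE)
  then show ?thesis unfolding eval_fm.simps(3,4) by (intro T2.impI)
qed

text \<open>Reduces to \<open>T2.ind\<close> for membership in \<open>S\<close>, a small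
  proposition. The hypotheses must be well formed at three depths: outside, below the quantifier of
  the conclusion, and inside the induction step.\<close>

lemma induction_sound:
  assumes wf: "wf_hyps \<Gamma> \<Phi>" "wf_hyps (TyN # \<Gamma>) (map lprop_lift \<Phi>)"
      "wf_hyps (TyN # TyN # \<Gamma>) (map lprop_lift (map lprop_lift \<Phi>))"
    and S: "wt_tm S \<Gamma> TySetN"
  shows "\<Gamma> \<turnstile> Entails \<Phi> (Imp (Mem Zero S)
    (Imp (All TyN (Imp (Mem (Var 0) (tm_ren Suc S)) (Mem (Succ (Var 0)) (tm_ren Suc S))))
      (All TyN (Mem (Var 0) (tm_ren Suc S)))))"
proof (intro T2.impI T2.allI)
  let ?S1 = "tm_ren Suc S" and ?S2 = "tm_ren Suc (tm_ren Suc S)"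
  \<comment> \<open>The form of \<open>S\<close> inside the quantifier of the step hypothesis, once
    that hypothesis stands below two further binders.\<close>
  let ?S3 = "tm_ren Suc ?S2"
  let ?step = "\<lambda>S. All TyN (Imp (Mem (Var 0) S) (Mem (Succ (Var 0)) S))"
  let ?\<Phi> = "?step ?S1 # Mem Zero S # \<Phi>"
  have S1: "wt_tm ?S1 (TyN # \<Gamma>) TySetN" using S by (rule wt_shift)
  then have S2: "wt_tm ?S2 (TyN # TyN # \<Gamma>) TySetN" by (rule wt_shift)
  then have S3: "wt_tm ?S3 (TyN # TyN # TyN # \<Gamma>) TySetN" by (rule wt_shift)
  have lift1: "map lprop_lift ?\<Phi> = ?step ?S2 # Mem Zero ?S1 # map lprop_lift \<Phi>"
    by (simp add: tm_up_def ren_eq_subst subst_subst)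
  have lift2: "map lprop_lift (?step ?S2 # Mem Zero ?S1 # map lprop_lift \<Phi>) =
      ?step ?S3 # Mem Zero ?S2 # map lprop_lift (map lprop_lift \<Phi>)"
    by (simp add: tm_up_def ren_eq_subst subst_subst)
  show "\<forall>\<psi>\<in>set ?\<Phi>. \<Gamma> \<turnstile> IsProp \<psi>"
    using wf S S1 by (auto simp: wf_hyps_def intro!: wf_imp_IsProp)
  \<comment> \<open>\<open>S\<close> is shifted once for the quantified number and once for the
    induction variable. The induction then concludes at the quantified number
    \<open>Var 0\<close>.\<close>
  let ?P = "SMem (Var 0) ?S2"
  have "TyN # \<Gamma> \<turnstile> Entails (map lprop_lift ?\<Phi>) (V (sprop_inst (Var 0) ?P))"
  proof (rule T2.ind)
    show "TyN # TyN # \<Gamma> \<turnstile> IsSProp ?P" using S2 by (intro wt_imp_T2) simp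
    show "TyN # \<Gamma> \<turnstile> HasType (Var 0) TyN" by (intro wt_imp_T2) simp
    have "wf_hyps (TyN # \<Gamma>) (map lprop_lift ?\<Phi>)"
      unfolding lift1 using wf S1 S2 by (intro wf_hyps_Cons wf_imp_IsProp) simp_all
    then show "TyN # \<Gamma> \<turnstile> Entails (map lprop_lift ?\<Phi>) (V (sprop_inst Zero ?P))"
      by (rule entails_hyp) (simp only: lift1, simp add: inst_shift)
    let ?\<Psi> = "V ?P # ?step ?S3 # Mem Zero ?S2 # map lprop_lift (map lprop_lift \<Phi>)"
    have wf2: "wf_hyps (TyN # TyN # \<Gamma>) ?\<Psi>"
      using wf S2 S3 by (intro wf_hyps_Cons wf_imp_IsProp) simp_all
    have "TyN # TyN # \<Gamma> \<turnstile> Entails ?\<Psi> (?step ?S3)" using wf2 by (rule entails_hyp) simp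
    then have "TyN # TyN # \<Gamma> \<turnstile> Entails ?\<Psi>
        (lprop_inst (Var 0) (Imp (Mem (Var 0) ?S3) (Mem (Succ (Var 0)) ?S3)))"
      by (rule T2.allE) (intro wt_imp_T2, simp)
    then have "TyN # TyN # \<Gamma> \<turnstile> Entails ?\<Psi> (Imp (V ?P) (Mem (Succ (Var 0)) ?S2))"
      by (simp add: inst_shift)
    moreover have "TyN # TyN # \<Gamma> \<turnstile> Entails ?\<Psi> (V ?P)" using wf2 by (rule entails_hyp) simp
    ultimately have "TyN # TyN # \<Gamma> \<turnstile> Entails ?\<Psi> (Mem (Succ (Var 0)) ?S2)" by (rule T2.impE)
    then show "TyN # TyN # \<Gamma> \<turnstile> Entails (V ?P # map lprop_lift (map lprop_lift ?\<Phi>))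
        (V (sprop_subst (case_nat (Succ (Var 0)) (\<lambda>x. Var (Suc x))) ?P))"
      unfolding lift1 lift2 by (simp add: subst_ren ren_eq_subst subst_subst)
  qed
  then show "TyN # \<Gamma> \<turnstile> Entails (map lprop_lift ?\<Phi>) (Mem (Var 0) ?S1)"
    by (simp only: sprop_subst.simps tm_subst.simps inst_shift nat.case)
qed

lemma ACA0_axiom_sound:
  assumes "ACA0_axiom \<phi>" and env: "wt_env \<Gamma> \<rho> \<sigma>"
  shows "\<Gamma> \<turnstile> Entails (map (eval_fm \<rho> \<sigma>) \<Phi>) (eval_fm \<rho> \<sigma> \<phi>)"
proof -
  let ?\<Phi> = "map (eval_fm \<rho> \<sigma>) \<Phi>"
  have wf: "wf_hyps \<Gamma> ?\<Phi>" using env by (rule wf_hyps_eval)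
  have num: "wt_tm (\<rho> x) \<Gamma> TyN" for x using env by (simp add: wt_env_def)
  have eq: "\<Gamma> \<turnstile> Entails ?\<Phi> (Eq M N)" if "wt_tm M \<Gamma> TyN" "\<Gamma> \<turnstile> EqTm M N TyN" for M N
    using wf that by (rule entails_EqTm)
  show ?thesis
    using assms(1)
  proof cases
    case (Suc_neq_0 x)
    then show ?thesis using wf num by (simp add: succ_neq_zero)
  next
    case (Suc_inject x y)
    then show ?thesis using wf num by (simp add: succ_injective)
  next
    case (plus_0 x)
    then show ?thesis using num by (simp add: eq wt_plus_tm plus_tm_zero)
  next
    case (plus_Suc x y)
    then show ?thesis using num by (simp add: eq wt_plus_tm plus_tm_succ)
  next
    case (times_0 x)
    then show ?thesis using num by (simp add: eq wt_times_tm times_tm_zero)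
  next
    case (times_Suc x y)
    then show ?thesis using num by (simp add: eq wt_times_tm times_tm_succ)
  next
    case (comprehension \<psi>)
    then show ?thesis using comprehension_sound[OF _ _ env] by blast
  next
    case (induction X)
    \<comment> \<open>Passes one binder; iterating it reaches the depth of two that
      \<open>induction_sound\<close> asks for.\<close>
    have lift: "wf_hyps (A # \<Delta>) (map lprop_lift (map (eval_fm \<rho>' \<sigma>') \<Phi>)) \<and>
        wt_env (A # \<Delta>) (\<lambda>x. tm_ren Suc (\<rho>' x)) (\<lambda>X. tm_ren Suc (\<sigma>' X))"
      if "wt_env \<Delta> \<rho>' \<sigma>'" for A \<Delta> \<rho>' \<sigma>'
    proof
      show *: "wt_env (A # \<Delta>) (\<lambda>x. tm_ren Suc (\<rho>' x)) (\<lambda>X. tm_ren Suc (\<sigma>' X))"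
        using that by (simp add: wt_env_def wt_shift)
      show "wf_hyps (A # \<Delta>) (map lprop_lift (map (eval_fm \<rho>' \<sigma>') \<Phi>))"
        using wf_hyps_eval[OF *, of \<Phi>] by (simp add: lift_eval_fm o_def)
    qed
    have "wf_hyps (TyN # TyN # \<Gamma>) (map lprop_lift (map lprop_lift ?\<Phi>))"
      using lift[OF conjunct2[OF lift[OF env]]] by (simp add: lift_eval_fm o_def)
    then have "\<Gamma> \<turnstile> Entails ?\<Phi> (Imp (Mem Zero (\<sigma> X))
      (Imp (All TyN (Imp (Mem (Var 0) (tm_ren Suc (\<sigma> X))) (Mem (Succ (Var 0)) (tm_ren Suc (\<sigma> X)))))
        (All TyN (Mem (Var 0) (tm_ren Suc (\<sigma> X))))))"
      using wf lift[OF env] env by (intro induction_sound) (simp_all add: wt_env_def)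
    then show ?thesis using induction by (simp add: tm_up_def)
  qed
qed

text \<open>Context and environments are arbitrary in the induction, because a quantifier
  introduction interprets its premise over an extended context.\<close>

lemma ACA0_entails_sound:
  assumes "ACA0_entails \<Phi> \<phi>" "wt_env \<Gamma> \<rho> \<sigma>"
  shows "\<Gamma> \<turnstile> Entails (map (eval_fm \<rho> \<sigma>) \<Phi>) (eval_fm \<rho> \<sigma> \<phi>)"
  using assms
proof (induction arbitrary: \<Gamma> \<rho> \<sigma> rule: ACA0_entails.induct)
  case (axiom \<phi> \<Phi>)
  then show ?case by (rule ACA0_axiom_sound)
next
  case (hyp \<phi> \<Phi>)
  then show ?case by (intro entails_hyp wf_hyps_eval) simp_all
next
  case (botE \<Phi> \<phi>)
  from botE.IH[OF botE.prems] have "\<Gamma> \<turnstile> Entails (map (eval_fm \<rho> \<sigma>) \<Phi>) Bot" by simp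
  then show ?case by (rule T2.botE) (intro wf_imp_IsProp wf_eval_fm botE.prems)
next
  case (impI \<phi> \<Phi> \<psi>)
  from impI.IH[OF impI.prems] show ?case by (simp add: T2.impI)
next
  case (impE \<Phi> \<phi> \<psi>)
  from impE.IH(1)[OF impE.prems] impE.IH(2)[OF impE.prems] show ?case
    by (simp only: eval_fm.simps) (rule T2.impE)
next
  case (dne \<Phi> \<phi>)
  from dne.IH[OF dne.prems] show ?case by (simp add: T2.dne)
next
  case (allNI \<Phi> \<phi>)
  \<comment> \<open>Lifted formulas avoid number index 0, the only place where
    \<open>tm_up \<rho>\<close> is not a shift of \<open>\<rho>\<close>; so lifting before and after
    interpretation agree.\<close>
  have "map (eval_fm (tm_up \<rho>) (\<lambda>X. tm_ren Suc (\<sigma> X))) (map num_lift \<Phi>) =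
      map lprop_lift (map (eval_fm \<rho> \<sigma>) \<Phi>)"
    by (simp add: eval_num_subst lift_eval_fm tm_up_def)
  note prem = allNI.IH[OF wt_env_upN[OF allNI.prems], unfolded this]
  show ?case
    using wf_hyps_eval[OF allNI.prems, of \<Phi>] prem
    unfolding eval_fm.simps wf_hyps_def by (rule T2.allI)
next
  case (allNE \<Phi> \<phi> t)
  from allNE.IH[OF allNE.prems] show ?case
    unfolding eval_num_inst eval_fm.simps
    by (rule T2.allE) (intro wt_imp_T2 wt_eval_tm[OF allNE.prems])
next
  case (allSI \<Phi> \<phi>)
  have "map (eval_fm (\<lambda>x. tm_ren Suc (\<rho> x)) (tm_up \<sigma>)) (map set_lift \<Phi>) =
      map lprop_lift (map (eval_fm \<rho> \<sigma>) \<Phi>)"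
    by (simp add: eval_set_subst lift_eval_fm tm_up_def)
  note prem = allSI.IH[OF wt_env_upS[OF allSI.prems], unfolded this]
  show ?case
    using wf_hyps_eval[OF allSI.prems, of \<Phi>] prem
    unfolding eval_fm.simps wf_hyps_def by (rule T2.allI)
next
  case (allSE \<Phi> \<phi> Y)
  from allSE.IH[OF allSE.prems] show ?case
    unfolding eval_set_inst eval_fm.simps
    by (rule T2.allE) (use allSE.prems in \<open>simp add: wt_env_def wt_imp_T2\<close>)
next
  case (eq_refl \<Phi> t)
  have "wf_hyps \<Gamma> (map (eval_fm \<rho> \<sigma>) \<Phi>)" using eq_refl by (rule wf_hyps_eval)
  then show ?case using wt_eval_tm[OF eq_refl]
    unfolding eval_fm.simps by (intro T2.eq_refl wt_imp_T2) (simp_all add: wf_hyps_def)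
next
  case (eq_subst \<Phi> s t \<phi>)
  have "TyN # \<Gamma> \<turnstile> IsProp (eval_fm (tm_up \<rho>) (\<lambda>X. tm_ren Suc (\<sigma> X)) \<phi>)"
    by (intro wf_imp_IsProp wf_eval_fm wt_env_upN eq_subst.prems)
  with eq_subst.IH(1)[OF eq_subst.prems] eq_subst.IH(2)[OF eq_subst.prems] show ?case
    unfolding eval_num_inst eval_fm.simps by (blast intro: T2.eq_subst)
qed

section \<open>Variables of the declared context\<close>

lemma position_less: "x \<in> set xs \<Longrightarrow> position xs x < length xs"
  by (induction xs) auto

text \<open>The latest declaration has index 0, so set variables fill the indices below
  \<open>length Xs\<close> and number variables start at that offset.\<close>

lemma ctx_eq_replicate: "ctx xs Xs = replicate (length Xs) TySetN @ replicate (length xs) TyN"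
  by (simp add: ctx_def map_replicate_const)

theorem mainTheorem3:
  fixes xs Xs :: "nat list" and \<phi> :: lfm
  assumes "distinct xs" and "distinct Xs"
    and "num_fv \<phi> \<subseteq> set xs" and "set_fv \<phi> \<subseteq> set Xs"
    and "ACA0_provable \<phi>"
  shows "ctx xs Xs \<turnstile> Entails [] (translation xs Xs \<phi>)"
proof -
  \<comment> \<open>Undeclared variables have no type in the context; the closed defaults
    \<open>Zero\<close> and \<open>Compr SBot\<close> make the environments total and well
    typed.\<close>
  define \<rho> where "\<rho> x = (if x \<in> set xs then Var (length Xs + position (rev xs) x) else Zero)" for x
  define \<sigma> where "\<sigma> X = (if X \<in> set Xs then Var (position (rev Xs) X) else Compr SBot)" for X
  have "wt_env (ctx xs Xs) \<rho> \<sigma>"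
    using position_less[of _ "rev xs"] position_less[of _ "rev Xs"]
    by (auto simp: wt_env_def \<rho>_def \<sigma>_def ctx_eq_replicate nth_append trans_less_add1)
  with assms(5) have "ctx xs Xs \<turnstile> Entails [] (eval_fm \<rho> \<sigma> \<phi>)"
    unfolding ACA0_provable_def using ACA0_entails_sound by fastforce
  \<comment> \<open>All free variables of \<open>\<phi>\<close> are declared, so the defaults are
    never consulted.\<close>
  moreover have "translation xs Xs \<phi> = eval_fm \<rho> \<sigma> \<phi>"
    unfolding translation_def trans_fm_eq_eval
    using assms(3,4) by (intro eval_fm_cong) (auto simp: \<rho>_def \<sigma>_def)
  ultimately show ?thesis by simp
qed

end
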